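(* Let $n\ge3$ be an integer and let $$\varphi(z)=\int_0^z(1-\zeta^n)^{-2/n}\,d\zeta,\qquad z\in\mathbb{D},$$ which maps the unit disk $\mathbb{D}$ conformally onto a regular $n$-gon. Define, for $z\in\mathbb{D}$, $$h(z)=z\,F_1\left(\frac1n,\,1+\frac2n,\,1;\,1+\frac1n;\,z^n,-z^n\right),$$ $$g(z)=\frac{z^{2n+1}}{2n+1}\,F_1\left(2+\frac1n,\,1+\frac2n,\,1;\,3+\frac1n;\,z^n,-z^n\right).$$ Then $f=h+\overline{g}$ is the harmonic shear of $\varphi$ with dilatation $\omega(z)=z^{2n}$, and $f$ maps $\mathbb{D}$ univalently onto a domain which is convex in the horizontal direction.
   Context: $\mathbb{D}=\{z\in\mathbb{C}:|z|<1\}$; the power $(1-\zeta^n)^{-2/n}$ is the principal branch. $F_1$ is the first Appell hypergeometric function $$F_1(a,b_1,b_2;c;x,y)=\sum_{k=0}^\infty\sum_{l=0}^\infty\frac{(a)_{k+l}(b_1)_k(b_2)_l}{(c)_{k+l}\,k!\,l!}x^ky^l,\qquad |x|,|y|<1,$$ where $(\alpha)_0=1$ and $(\alpha)_j=\alpha(\alpha+1)\cdots(\alpha+j-1)$ is the Pochhammer symbol. Univalent means injective. A domain $\Omega\subset\mathbb{C}$ is convex in the horizontal direction (CHD) if its intersection with each horizontal line is connected (or empty). For a conformal mapping $\varphi$ of $\mathbb{D}$ onto a CHD domain with $\varphi(0)=0$, and an analytic $\omega$ with $|\omega|<1$ in $\mathbb{D}$, the harmonic shear of $\varphi$ with dilatation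 $\omega$ is the harmonic function $f=h+\overline{g}$, where $h,g$ are analytic in $\mathbb{D}$, $h(0)=g(0)=0$, $h-g=\varphi$ and $g'=\omega h'$. *)

theory Defs
  imports "HOL-Complex_Analysis.Complex_Analysis"
begin

text \<open>The first Appell function as the iterated double series. It is meant for
  \<open>cmod x < 1\<close>, \<open>cmod y < 1\<close> and \<open>c\<close> not a non-positive integer, where the double series
  converges absolutely; other arguments are not used.\<close>

definition appell_F1 ::
    "complex \<Rightarrow> complex \<Rightarrow> complex \<Rightarrow> complex \<Rightarrow> complex \<Rightarrow> complex \<Rightarrow> complex" where
  "appell_F1 a b1 b2 c x y =
     (\<Sum>k. \<Sum>l. pochhammer a (k + l) * pochhammer b1 k * pochhammer b2 l /
              (pochhammer c (k + l) * fact k * fact l) * x ^ k * y ^ l)"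

definition domain_CHD :: "complex set \<Rightarrow> bool" where
  "domain_CHD \<Omega> \<longleftrightarrow>
     open \<Omega> \<and> connected \<Omega> \<and> \<Omega> \<noteq> {} \<and> (\<forall>t::real. connected (\<Omega> \<inter> {w. Im w = t}))"

definition conformal_onto :: "(complex \<Rightarrow> complex) \<Rightarrow> complex set \<Rightarrow> complex set \<Rightarrow> bool" where
  "conformal_onto \<phi> A B \<longleftrightarrow> \<phi> holomorphic_on A \<and> inj_on \<phi> A \<and> \<phi> ` A = B"

text \<open>The polygon is the open region, not the closed polygon or its boundary curve.\<close>

definition regular_ngon :: "nat \<Rightarrow> complex set \<Rightarrow> bool" where
  "regular_ngon n \<Omega> \<longleftrightarrow>
     (\<exists>(c::complex) (r::real) (\<theta>::real). r > 0 \<and>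
        \<Omega> = interior (convex hull
          ((\<lambda>k. c + of_real r * cis (\<theta> + 2 * pi * real k / real n)) ` {..<n})))"

text \<open>\<open>f\<close> is the harmonic shear of \<open>\<phi>\<close> with dilatation \<open>\<omega>\<close>, and \<open>h\<close>, \<open>g\<close> are its
  (uniquely determined) analytic and co-analytic parts. All conditions concern values on
  the unit disk only. Harmonicity of \<open>f\<close> is automatic from \<open>f = h + cnj g\<close>.\<close>

definition is_harmonic_shear ::
    "(complex \<Rightarrow> complex) \<Rightarrow> (complex \<Rightarrow> complex) \<Rightarrow>
     (complex \<Rightarrow> complex) \<Rightarrow> (complex \<Rightarrow> complex) \<Rightarrow> (complex \<Rightarrow> complex) \<Rightarrow> bool" where
  "is_harmonic_shear \<phi> \<omega> h g f \<longleftrightarrow>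
     (\<exists>\<Omega>. domain_CHD \<Omega> \<and> conformal_onto \<phi> (ball 0 1) \<Omega>) \<and> \<phi> 0 = 0 \<and>
     \<omega> holomorphic_on ball 0 1 \<and> (\<forall>z\<in>ball 0 1. cmod (\<omega> z) < 1) \<and>
     h holomorphic_on ball 0 1 \<and> g holomorphic_on ball 0 1 \<and> h 0 = 0 \<and> g 0 = 0 \<and>
     (\<forall>z\<in>ball 0 1. h z - g z = \<phi> z) \<and>
     (\<forall>z\<in>ball 0 1. deriv g z = \<omega> z * deriv h z) \<and>
     (\<forall>z\<in>ball 0 1. f z = h z + cnj (g z))"

end

theory Submission
  imports Defs "HOL-Real_Asymp.Real_Asymp"
begin

text \<open>Since \<open>(p/n)\<^sub>m / (1 + p/n)\<^sub>m = p / (p + n m)\<close>, both Appell series are termwise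
  primitives of \<open>z^(p-1) (1 - z^n)^(-1-2/n) / (1 + z^n)\<close> with \<open>p = 1\<close> and \<open>p = 2n + 1\<close>; this gives
  \<open>g' = z^(2n) h'\<close> and \<open>h' - g' = (1 - z^n)^(-2/n)\<close>.

  The power series of \<open>\<phi>\<close> converges absolutely on the closed disk because \<open>2/n < 1\<close>, and on each
  arc between consecutive \<open>n\<close>-th roots of unity the argument of the boundary derivative is
  constant, so the arcs run along the edges of the polygon. The maximum principle puts the image
  inside the closed polygon, a clopen argument fills its interior, and injectivity follows from
  \<open>Re \<phi>' > 0\<close>.

  Finally \<open>f = F \<circ> \<phi>\<close>, where \<open>F w = w + 2 Re (g (\<phi>\<^sup>-\<^sup>1 w))\<close> preserves horizontal lines and is strictly
  increasing along them, because its derivative there is \<open>Re ((1 + \<omega>) / (1 - \<omega>)) > 0\<close>.\<close>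

subsection \<open>Appell series as primitives\<close>

text \<open>Differentiation cancels the denominators \<open>n * k + p\<close> and leaves
  \<open>z ^ (p - 1)\<close> times a power series in \<open>z ^ n\<close>. It may be done termwise
  by the Weierstrass test on a ball of radius \<open>r\<close> strictly between
  \<open>cmod z\<close> and 1, where \<open>cmod x ^ n \<le> r\<close>.\<close>

lemma DERIV_series_power_gaps:
  fixes b :: "nat \<Rightarrow> complex" and n p :: nat
  assumes n: "n > 0" and p: "p > 0"
    and sm: "\<And>r. 0 \<le> r \<Longrightarrow> r < 1 \<Longrightarrow> summable (\<lambda>k. cmod (b k) * r ^ k)"
    and z: "cmod z < 1"
  shows "summable (\<lambda>k. b k * z ^ (n * k + p) / of_nat (n * k + p))"
    and "((\<lambda>z. \<Sum>k. b k * z ^ (n * k + p) / of_nat (n * k + p)) has_field_derivative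
           z ^ (p - 1) * (\<Sum>k. b k * (z ^ n) ^ k)) (at z)"
proof -
  define r where "r = (1 + cmod z) / 2"
  have r: "0 \<le> r" "r < 1" "cmod z < r" using z by (auto simp: r_def)
  define f where "f = (\<lambda>k z. b k * z ^ (n * k + p) / of_nat (n * k + p))"
  define f' where "f' = (\<lambda>k z. z ^ (p - 1) * (b k * (z ^ n) ^ k))"
  have pw: "cmod x ^ n \<le> r" if "cmod x \<le> r" for x :: complex
  proof -
    have "cmod x ^ n \<le> cmod x ^ 1" using that r n by (intro power_decreasing) auto
    then show ?thesis using that by simp
  qed
  have bound: "cmod (f' k x) \<le> cmod (b k) * r ^ k" if "x \<in> ball 0 r" for k x
  proof -
    have x: "cmod x \<le> r" using that by auto
    have "cmod x ^ (p - 1) * (cmod (b k) * (cmod x ^ n) ^ k) \<le> 1 * (cmod (b k) * r ^ k)"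
      using x r pw[OF x] by (intro mult_mono power_mono power_le_one) auto
    then show ?thesis by (simp add: f'_def norm_mult norm_power)
  qed
  have der: "(f k has_field_derivative f' k x) (at x within ball 0 r)" for k x
  proof -
    have "x ^ (n * k + p - 1) = x ^ (p - 1) * (x ^ n) ^ k"
      using p by (simp flip: power_mult power_add add: add.commute)
    moreover have "of_nat (n * k + p) \<noteq> (0::complex)" using p by (simp del: of_nat_add)
    ultimately show ?thesis
      unfolding f_def f'_def by (auto intro!: derivative_eq_intros simp: field_simps simp del: of_nat_add of_nat_mult)
  qed
  have uc: "uniformly_convergent_on (ball 0 r) (\<lambda>m x. \<Sum>i<m. f' i x)"
    by (rule Weierstrass_m_test'[OF bound sm[OF r(1,2)]])
  \<comment> \<open>Every term vanishes at 0 because \<open>p > 0\<close>; this is the point of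
    convergence from which the termwise differentiation starts.\<close>
  have s0: "summable (\<lambda>k. f k 0)" using p by (simp add: f_def power_0_left)
  have "0 \<in> ball (0::complex) r" "z \<in> interior (ball 0 r)" using r le_less_trans[of 0 "cmod z" r] by auto
  note * = has_field_derivative_series'[OF convex_ball der uc this(1) s0 this(2)]
  show "summable (\<lambda>k. b k * z ^ (n * k + p) / of_nat (n * k + p))"
    using *(1) by (simp add: f_def)
  have "summable (\<lambda>k. b k * (z ^ n) ^ k)"
  proof (rule summable_comparison_test[OF _ sm[OF r(1,2)]], intro exI allI impI)
    fix k
    show "norm (b k * (z ^ n) ^ k) \<le> cmod (b k) * r ^ k"
      using pw[of z] r by (auto simp: norm_mult norm_power intro!: mult_left_mono power_mono)
  qed
  then have "(\<Sum>k. f' k z) = z ^ (p - 1) * (\<Sum>k. b k * (z ^ n) ^ k)"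
    unfolding f'_def by (rule suminf_mult)
  then show "((\<lambda>z. \<Sum>k. b k * z ^ (n * k + p) / of_nat (n * k + p)) has_field_derivative
           z ^ (p - 1) * (\<Sum>k. b k * (z ^ n) ^ k)) (at z)"
    using *(2) by (simp add: f_def)
qed

text \<open>The sign change that makes the generalized binomial series and its radius of convergence
  available for rising factorials.\<close>

lemma pochhammer_fact_gbinomial:
  fixes a :: complex
  shows "pochhammer a k / fact k = (-1) ^ k * ((- a) gchoose k)"
  by (simp add: gbinomial_pochhammer flip: power_mult_distrib)

lemma pochhammer_series_sums:
  fixes a x :: complex
  assumes "cmod x < 1"
  shows "(\<lambda>k. pochhammer a k / fact k * x ^ k) sums ((1 - x) powr (- a))"
  using gen_binomial_complex[of "- x" "- a"] assms
  by (simp add: pochhammer_fact_gbinomial power_minus[of x] mult_ac)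

lemma pochhammer_series_abs_summable:
  fixes a :: complex
  assumes "0 \<le> r" "r < 1"
  shows "summable (\<lambda>k. cmod (pochhammer a k / fact k) * r ^ k)"
proof -
  have "ereal (cmod (of_real r)) < conv_radius (\<lambda>k. (- a) gchoose k)"
    using assms by (simp add: conv_radius_gchoose)
  from abs_summable_in_conv_radius[OF this] show ?thesis
    using assms by (simp only: pochhammer_fact_gbinomial) (simp add: norm_mult norm_power)
qed

text \<open>Both \<open>a * pochhammer (1 + a) m\<close> and
  \<open>pochhammer a m * (a + of_nat m)\<close> equal \<open>pochhammer a (Suc m)\<close>.\<close>

lemma pochhammer_ratio_Suc_base:
  fixes a :: complex
  assumes "a \<noteq> 0" "\<And>j. a + of_nat j \<noteq> 0"
  shows "pochhammer a m / pochhammer (1 + a) m = a / (a + of_nat m)"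
proof -
  have "a * pochhammer (1 + a) m = pochhammer a m * (a + of_nat m)"
    using pochhammer_rec[of a m] pochhammer_rec'[of a m] by (simp add: add_ac mult_ac)
  moreover have "pochhammer (1 + a) m \<noteq> 0"
  proof
    assume "pochhammer (1 + a) m = 0"
    then obtain j where "1 + a = - of_nat j" by (auto simp: pochhammer_eq_0_iff)
    then have "a + of_nat (Suc j) = 0" by (simp add: add_ac eq_neg_iff_add_eq_0)
    then show False using assms(2) by blast
  qed
  ultimately show ?thesis using assms(2)[of m] by (simp add: field_simps)
qed

text \<open>The lower parameter exceeds the first upper one by 1, so the Pochhammer quotient
  collapses to \<open>p / (p + n * (k + l))\<close> and the double series is a termwise primitive.
  After differentiation the sum over \<open>l\<close> is geometric in \<open>- (z ^ n)\<close>, and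
  the sum over \<open>k\<close> is the binomial series.\<close>

lemma appell_F1_primitive:
  fixes n p :: nat and a :: complex
  assumes n: "n > 0" and p: "p > 0" and z: "cmod z < 1"
  shows "((\<lambda>z. z ^ p / of_nat p *
            appell_F1 (of_nat p / of_nat n) a 1 (1 + of_nat p / of_nat n) (z ^ n) (- (z ^ n)))
          has_field_derivative z ^ (p - 1) * (1 - z ^ n) powr (- a) / (1 + z ^ n)) (at z)"
proof -
  define c where "c = (\<lambda>k. pochhammer a k / fact k)"
  \<comment> \<open>\<open>f k\<close> is the inner sum over \<open>l\<close> with the factor
    \<open>z ^ p / p\<close> absorbed. The order of summation of \<open>appell_F1\<close> is kept,
    so the inner and outer sums are differentiated one after the other without any
    rearrangement.\<close>
  define f where "f = (\<lambda>k z. \<Sum>l. c k * (-1) ^ l * z ^ (n * l + (n * k + p)) / of_nat (n * l + (n * k + p)))"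
  define f' where "f' = (\<lambda>k z. z ^ (n * k + p - 1) * (\<Sum>l. c k * (-1) ^ l * (z ^ n) ^ l))"
  have smk: "summable (\<lambda>l. cmod (c k * (-1) ^ l) * r ^ l)" if "0 \<le> r" "r < 1" for k r
    using that by (simp add: norm_mult norm_power summable_mult summable_geometric)
  have znz: "1 + x ^ n \<noteq> 0" "cmod (x ^ n) < 1" if "cmod x < 1" for x :: complex
  proof -
    show "cmod (x ^ n) < 1" using that n by (simp add: norm_power power_less_one_iff)
    then show "1 + x ^ n \<noteq> 0"
      by (metis add_eq_0_iff norm_minus_cancel norm_one order_less_irrefl)
  qed
  have f'_eq: "f' k x = c k * (x ^ n) ^ k * (x ^ (p - 1) / (1 + x ^ n))" if "cmod x < 1" for k x
  proof -
    have "(\<lambda>l. c k * (- (x ^ n)) ^ l) sums (c k * (1 / (1 - (- (x ^ n)))))"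
      using znz[OF that] by (intro sums_mult geometric_sums) auto
    then have "(\<Sum>l. c k * (-1) ^ l * (x ^ n) ^ l) = c k / (1 + x ^ n)"
      by (subst (asm) power_minus) (simp add: sums_iff mult_ac)
    moreover have "x ^ (n * k + p - 1) = x ^ (p - 1) * (x ^ n) ^ k"
      using p by (simp flip: power_mult power_add add: add.commute)
    ultimately show ?thesis by (simp add: f'_def)
  qed
  have derk: "(f k has_field_derivative f' k x) (at x)" if "cmod x < 1" for k x
    unfolding f_def f'_def
    using DERIV_series_power_gaps(2)[OF n _ smk that, where p = "n * k + p"] p by simp
  have appell: "x ^ p / of_nat p *
        appell_F1 (of_nat p / of_nat n) a 1 (1 + of_nat p / of_nat n) (x ^ n) (- (x ^ n)) =
      (\<Sum>k. f k x)" if sk: "summable (\<lambda>k. f k x)" and x: "cmod x < 1" for x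
  \<comment> \<open>The factor \<open>x ^ p\<close> is divided out in the second case; at 0 both
    sides vanish because \<open>p > 0\<close>.\<close>
  proof (cases "x = 0")
    case True
    then show ?thesis using p by (simp add: f_def power_0_left)
  next
    case False
    define q :: complex where "q = of_nat p / of_nat n"
    have q: "q \<noteq> 0" "q + of_nat j \<noteq> 0" for j
    proof -
      have "q + of_nat j = of_nat (p + n * j) / of_nat n" using n by (simp add: q_def field_simps)
      also have "\<dots> \<noteq> 0" using n p by (simp del: of_nat_add)
      finally show "q + of_nat j \<noteq> 0" .
      show "q \<noteq> 0" using n p by (simp add: q_def)
    qed
    have summand: "pochhammer q (k + l) * pochhammer a k * pochhammer 1 l /
              (pochhammer (1 + q) (k + l) * fact k * fact l) * (x ^ n) ^ k * (- (x ^ n)) ^ l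
        = of_nat p / x ^ p * (c k * (-1) ^ l * x ^ (n * l + (n * k + p)) / of_nat (n * l + (n * k + p)))"
      (is "?L = ?R") for k l
    proof -
      have "q / (q + of_nat (k + l)) = of_nat p / of_nat (n * l + (n * k + p))"
      proof -
        have "q + of_nat (k + l) = of_nat (n * l + (n * k + p)) / of_nat n"
          using n by (simp add: q_def field_simps)
        then show ?thesis using n by (simp add: q_def del: of_nat_add of_nat_mult)
      qed
      then have "pochhammer q (k + l) / pochhammer (1 + q) (k + l) = of_nat p / of_nat (n * l + (n * k + p))"
        using pochhammer_ratio_Suc_base[OF q(1) q(2)] by simp
      moreover have "?L = pochhammer q (k + l) / pochhammer (1 + q) (k + l) * c k * ((x ^ n) ^ k * (- (x ^ n)) ^ l)"
        by (simp add: c_def flip: pochhammer_fact)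
      moreover have "(x ^ n) ^ k * (- (x ^ n)) ^ l = (-1) ^ l * x ^ (n * l + (n * k + p)) / x ^ p"
        using False by (simp add: power_minus[of "x ^ n"] power_add power_mult)
      ultimately show ?thesis by (simp add: mult_ac)
    qed
    have inner: "summable (\<lambda>l. c k * (-1) ^ l * x ^ (n * l + (n * k + p)) / of_nat (n * l + (n * k + p)))" for k
      by (rule DERIV_series_power_gaps(1)[OF n _ smk x]) (use p in simp)
    have "appell_F1 q a 1 (1 + q) (x ^ n) (- (x ^ n)) = (\<Sum>k. of_nat p / x ^ p * f k x)"
      unfolding appell_F1_def summand f_def by (subst suminf_mult[OF inner]) simp
    also have "\<dots> = of_nat p / x ^ p * (\<Sum>k. f k x)"
      by (rule suminf_mult[OF sk])
    finally show ?thesis using False p by (simp add: q_def)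
  qed
  have main: "summable (\<lambda>k. f k x)"
    "((\<lambda>x. \<Sum>k. f k x) has_field_derivative (\<Sum>k. f' k x)) (at x)" if x: "cmod x < 1" for x
  proof -
    define r where "r = (1 + cmod x) / 2"
    have r: "0 \<le> r" "r < 1" "cmod x < r" using x by (auto simp: r_def)
    \<comment> \<open>On this ball \<open>cmod (1 + y ^ n)\<close> is at least \<open>1 - r\<close>,
      so the geometric factor is bounded uniformly and the absolutely convergent binomial series
      serves as majorant.\<close>
    have bound: "cmod (f' k y) \<le> cmod (c k) * r ^ k * (1 / (1 - r))" if "y \<in> ball 0 r" for k y
    proof -
      have y: "cmod y \<le> r" "cmod y < 1" using that r by auto
      have "cmod y ^ n \<le> cmod y ^ 1" using y n by (intro power_decreasing) auto
      then have yn: "cmod y ^ n \<le> r" using y by simp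
      have "1 - r \<le> cmod (1 + y ^ n)"
        using norm_triangle_ineq2[of 1 "- (y ^ n)"] yn by (simp add: norm_power)
      then have "cmod y ^ (p - 1) / cmod (1 + y ^ n) \<le> 1 / (1 - r)"
        using r y by (intro frac_le power_le_one) auto
      then show ?thesis
        unfolding f'_eq[OF y(2)] norm_mult norm_divide norm_power
        using r yn by (intro mult_mono power_mono) auto
    qed
    have "summable (\<lambda>k. cmod (c k) * r ^ k * (1 / (1 - r)))"
      unfolding c_def by (rule summable_mult2[OF pochhammer_series_abs_summable[OF r(1,2)]])
    note uc = Weierstrass_m_test'[where A = "ball 0 r" and f = f', OF bound this]
    have mem: "0 \<in> ball (0::complex) r" "x \<in> interior (ball 0 r)"
      using r le_less_trans[of 0 "cmod x" r] by auto
    have s0: "summable (\<lambda>k. f k 0)" using p by (simp add: f_def power_0_left)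
    have "(f k has_field_derivative f' k y) (at y within ball 0 r)" if "y \<in> ball 0 r" for k y
      using derk[of y k] that r by (simp add: has_field_derivative_at_within)
    note * = has_field_derivative_series'[OF convex_ball this uc mem(1) s0 mem(2)]
    show "summable (\<lambda>k. f k x)" by (rule *(1))
    show "((\<lambda>x. \<Sum>k. f k x) has_field_derivative (\<Sum>k. f' k x)) (at x)" by (rule *(2))
  qed
  have "(\<lambda>k. c k * (z ^ n) ^ k * (z ^ (p - 1) / (1 + z ^ n))) sums
      ((1 - z ^ n) powr (- a) * (z ^ (p - 1) / (1 + z ^ n)))"
    unfolding c_def using znz[OF z] by (intro sums_mult2 pochhammer_series_sums)
  then have "(\<Sum>k. f' k z) = z ^ (p - 1) * (1 - z ^ n) powr (- a) / (1 + z ^ n)"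
    by (simp add: f'_eq[OF z] sums_iff mult_ac)
  with main(2)[OF z] have "((\<lambda>x. \<Sum>k. f k x) has_field_derivative
      z ^ (p - 1) * (1 - z ^ n) powr (- a) / (1 + z ^ n)) (at z)" by simp
  then show ?thesis
    by (rule has_field_derivative_transform_within_open[where S = "ball 0 1"])
      (use z main(1) appell in auto)
qed

subsection \<open>The conformal map onto the regular polygon\<close>

text \<open>With \<open>a = 2 / n\<close> the terms decay like \<open>k\<close> to the power
  \<open>a - 2\<close>, so the ratio test is inconclusive, while the Raabe limit is
  \<open>2 - a\<close>. It exceeds 1 exactly because \<open>n \<ge> 3\<close> gives
  \<open>a < 1\<close>.\<close>

lemma summable_ngon_coeffs:
  assumes "n \<ge> 3"
  shows "summable (\<lambda>k. pochhammer (2 / real n) k / fact k / real (n * k + 1))"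
proof (rule raabes_test_convergence)
  define a where "a = 2 / real n"
  define N where "N = real n"
  have a: "a > 0" "a < 1" and N: "N > 0" using assms by (auto simp: a_def N_def)
  let ?f = "\<lambda>k. pochhammer (2 / real n) k / fact k / real (n * k + 1)"
  have pos: "?f k > 0" for k
    using assms by (intro divide_pos_pos pochhammer_pos) (auto intro: add_pos_nonneg)
  then show "eventually (\<lambda>k. ?f k > 0) sequentially" by simp
  have ratio: "?f k / ?f (Suc k) = (real k + 1) / (a + real k) * ((N * real k + N + 1) / (N * real k + 1))" for k
  proof -
    have "N * real k \<ge> 0" using N by simp
    then have pos: "a + real k > 0" "N * real k + N + 1 > 0" "N * real k + 1 > 0"
      using a N by linarith+
    have P: "pochhammer a k > 0" using a by (intro pochhammer_pos)
    have 1: "?f k = pochhammer a k / fact k / (N * real k + 1)"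
      by (simp add: a_def N_def)
    have 2: "?f (Suc k) = (a + real k) * pochhammer a k / ((real k + 1) * fact k) / (N * real k + N + 1)"
      by (simp add: a_def N_def pochhammer_rec' algebra_simps)
    show ?thesis
      unfolding 1 2 using pos P by simp
  qed
  have "(\<lambda>k. real k * (?f k / ?f (Suc k) - 1)) \<longlonglongrightarrow> 2 - a"
    unfolding ratio using a N by real_asymp (simp add: field_simps)
  then have "liminf (\<lambda>k. ereal (real k * (?f k / ?f (Suc k) - 1))) = ereal (2 - a)"
    by (intro lim_imp_Liminf) auto
  then show "liminf (\<lambda>k. ereal (of_nat k * (?f k / ?f (Suc k) - 1))) > 1"
    using a by simp
qed

text \<open>The Schwarz-Christoffel map of the polygon. The power series, unlike the integral, gives
  values on the whole unit circle at once, including the \<open>n\<close>-th roots of unity where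
  the integrand is singular.\<close>

definition ngon_map :: "nat \<Rightarrow> complex \<Rightarrow> complex" where
  "ngon_map n z = (\<Sum>k. pochhammer (2 / of_nat n) k / fact k * z ^ (n * k + 1) / of_nat (n * k + 1))"

text \<open>The value of \<open>ngon_map n\<close> at 1, which becomes the circumradius; the real
  terms make its positivity visible.\<close>

definition ngon_radius :: "nat \<Rightarrow> real" where
  "ngon_radius n = (\<Sum>k. pochhammer (2 / real n) k / fact k / real (n * k + 1))"

text \<open>The index is not reduced modulo \<open>n\<close>, so every edge, the last one included,
  joins \<open>j\<close> to \<open>Suc j\<close>.\<close>

definition ngon_vertex :: "nat \<Rightarrow> nat \<Rightarrow> complex" where
  "ngon_vertex n k = of_real (ngon_radius n) * cis (2 * pi * real k / real n)"

lemma of_real_pochhammer_coeff: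
  "pochhammer (2 / of_nat n) k / fact k = complex_of_real (pochhammer (2 / real n) k / fact k)"
  by (simp flip: pochhammer_of_real)

lemma norm_ngon_coeff_le:
  assumes "n > 0" "cmod z \<le> 1"
  shows "cmod (pochhammer (2 / of_nat n) k / fact k * z ^ (n * k + 1) / complex_of_nat (n * k + 1))
    \<le> pochhammer (2 / real n) k / fact k / real (n * k + 1)"
proof -
  have "pochhammer (2 / real n) k \<ge> 0"
    using assms by (intro pochhammer_nonneg) auto
  then have "cmod (pochhammer (2 / of_nat n) k / fact k * z ^ (n * k + 1) / of_nat (n * k + 1)) =
      pochhammer (2 / real n) k / fact k * cmod z ^ (n * k + 1) / real (n * k + 1)"
    unfolding of_real_pochhammer_coeff norm_mult norm_divide norm_power norm_of_nat norm_of_real by simp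
  also have "\<dots> \<le> pochhammer (2 / real n) k / fact k * 1 / real (n * k + 1)"
    using assms \<open>pochhammer (2 / real n) k \<ge> 0\<close>
    by (intro divide_right_mono mult_left_mono power_le_one) auto
  finally show ?thesis by simp
qed

lemma summable_ngon_map:
  assumes "n \<ge> 3" "cmod z \<le> 1"
  shows "summable (\<lambda>k. pochhammer (2 / of_nat n) k / fact k * z ^ (n * k + 1) / of_nat (n * k + 1))"
  using norm_ngon_coeff_le[OF _ assms(2)] assms(1)
  by (intro summable_comparison_test'[OF summable_ngon_coeffs[OF assms(1)], where N = 0]) auto

lemma continuous_on_ngon_map:
  assumes "n \<ge> 3"
  shows "continuous_on (cball 0 1) (ngon_map n)"
proof -
  have "uniform_limit (cball 0 1)
      (\<lambda>m z. \<Sum>k<m. pochhammer (2 / of_nat n) k / fact k * z ^ (n * k + 1) / complex_of_nat (n * k + 1))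
      (\<lambda>z. \<Sum>k. pochhammer (2 / of_nat n) k / fact k * z ^ (n * k + 1) / of_nat (n * k + 1)) sequentially"
    using norm_ngon_coeff_le[of n] summable_ngon_coeffs[OF assms] assms
    by (intro Weierstrass_m_test) auto
  moreover have nz: "complex_of_nat (n * k + 1) \<noteq> 0" for k
    unfolding of_nat_eq_0_iff by simp
  have "continuous_on (cball 0 1)
      (\<lambda>z. \<Sum>k<m. pochhammer (2 / of_nat n) k / fact k * z ^ (n * k + 1) / complex_of_nat (n * k + 1))" for m
    by (intro continuous_intros ballI nz)
  ultimately show ?thesis
    unfolding ngon_map_def by (intro uniform_limit_theorem[rotated]) auto
qed

lemma DERIV_ngon_map:
  assumes n: "n \<ge> 3" and z: "cmod z < 1"
  shows "(ngon_map n has_field_derivative (1 - z ^ n) powr (- (2 / of_nat n))) (at z)"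
proof -
  have "cmod (z ^ n) < 1" using n z by (simp add: norm_power power_less_one_iff)
  from pochhammer_series_sums[OF this, of "2 / of_nat n"]
    DERIV_series_power_gaps(2)[of n 1 "\<lambda>k. pochhammer (2 / of_nat n) k / fact k", OF _ _ pochhammer_series_abs_summable z] n
  show ?thesis unfolding ngon_map_def by (simp add: sums_iff)
qed

lemma holomorphic_on_ngon_map:
  assumes "n \<ge> 3"
  shows "ngon_map n holomorphic_on ball 0 1"
  unfolding holomorphic_on_open[OF open_ball] using DERIV_ngon_map[OF assms] by (metis mem_ball_0)

lemma ngon_map_0 [simp]: "ngon_map n 0 = 0"
  by (simp add: ngon_map_def)

text \<open>Only the exponents \<open>n * k + 1\<close> occur, so an \<open>n\<close>-th root of
  unity factors out of every term. This symmetry reduces the boundary behaviour to a single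
  arc.\<close>

lemma ngon_map_rotate:
  assumes "n \<ge> 3" "cmod z \<le> 1" "w ^ n = 1"
  shows "ngon_map n (w * z) = w * ngon_map n z"
proof -
  have "(w * z) ^ (n * k + 1) = w * z ^ (n * k + 1)" for k
    using assms(3) by (simp add: power_mult_distrib power_mult)
  then have "ngon_map n (w * z) =
      (\<Sum>k. w * (pochhammer (2 / of_nat n) k / fact k * z ^ (n * k + 1) / of_nat (n * k + 1)))"
    by (simp only: ngon_map_def) (simp only: mult_ac times_divide_eq_left times_divide_eq_right)
  also have "\<dots> = w * ngon_map n z"
    unfolding ngon_map_def by (rule suminf_mult[OF summable_ngon_map[OF assms(1,2)]])
  finally show ?thesis .
qed

lemma ngon_map_1:
  assumes "n \<ge> 3"
  shows "ngon_map n 1 = of_real (ngon_radius n)"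
  unfolding ngon_map_def ngon_radius_def of_real_pochhammer_coeff
  by (subst suminf_of_real[OF summable_ngon_coeffs[OF assms]]) simp

lemma ngon_radius_pos:
  assumes "n \<ge> 3"
  shows "ngon_radius n > 0"
  unfolding ngon_radius_def using assms
  by (intro suminf_pos summable_ngon_coeffs divide_pos_pos pochhammer_pos) (auto intro: add_pos_nonneg)

text \<open>\<open>1 - z ^ n\<close> lies in the right half-plane, so its argument is below
  \<open>pi / 2\<close> in absolute value, and the exponent scales that argument by
  \<open>2 / n \<le> 1\<close>.\<close>

lemma Re_ngon_deriv_pos:
  assumes n: "n \<ge> 3" and z: "cmod z < 1"
  shows "Re ((1 - z ^ n) powr (- (2 / of_nat n))) > 0"
proof -
  have "cmod (z ^ n) < 1" using n z by (simp add: norm_power power_less_one_iff)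
  then have "Re (1 - z ^ n) > 0"
    using complex_Re_le_cmod[of "z ^ n"] by simp
  then have nz: "1 - z ^ n \<noteq> 0" and L: "\<bar>Im (Ln (1 - z ^ n))\<bar> < pi / 2"
    using Re_Ln_pos_lt_imp by fastforce+
  define y where "y = 2 / real n * Im (Ln (1 - z ^ n))"
  have "\<bar>y\<bar> = 2 / real n * \<bar>Im (Ln (1 - z ^ n))\<bar>"
    by (simp add: y_def abs_mult)
  also have "\<dots> \<le> 1 * \<bar>Im (Ln (1 - z ^ n))\<bar>"
    using n by (intro mult_right_mono) auto
  finally have "\<bar>y\<bar> < pi / 2" using L by simp
  then have "cos y > 0" by (intro cos_gt_zero_pi) auto
  moreover have "Im (- (2 / complex_of_nat n) * Ln (1 - z ^ n)) = - y"
    by (simp add: y_def Im_divide_of_nat)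
  ultimately show ?thesis
    using nz by (simp only: powr_def if_False Re_exp) simp
qed

section \<open>Boundary arcs and the edges of the polygon\<close>

lemma ngon_map_arc_has_vector_derivative:
  assumes n: "n \<ge> 3" and t: "0 < t" "t < 2 * pi / real n"
  shows "((\<lambda>t. ngon_map n (cis t)) has_vector_derivative
           of_real ((2 * sin (real n * t / 2)) powr (- (2 / real n))) * (\<i> * cis (pi / real n))) (at t)"
proof -
  \<comment> \<open>A starlike region containing the closed disk except the \<open>n\<close>-th roots of unity: a primitive on
    it continues the map analytically across the open arcs.\<close>
  define S where "S = {z::complex. 1 - z ^ n \<notin> \<real>\<^sub>\<le>\<^sub>0}"
  define d where "d = (\<lambda>z::complex. (1 - z ^ n) powr (- (2 / of_nat n)))"
  have opn: "open S"
  proof -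
    have "S = (\<lambda>z. 1 - z ^ n) -` (- \<real>\<^sub>\<le>\<^sub>0)" by (auto simp: S_def)
    moreover have "open ((\<lambda>z::complex. 1 - z ^ n) -` (- \<real>\<^sub>\<le>\<^sub>0))"
      by (intro open_vimage continuous_intros) (auto simp: open_Compl)
    ultimately show ?thesis by simp
  qed
  \<comment> \<open>The excluded points are those with \<open>z ^ n\<close> real and at least 1.
    Stretching away from 0 keeps them excluded, so shrinking towards 0 never leaves
    \<open>S\<close>.\<close>
  have scale: "of_real u * z \<in> S" if "z \<in> S" "0 \<le> u" "u \<le> 1" for u z
  proof (rule ccontr)
    assume "of_real u * z \<notin> S"
    then obtain s where s: "1 - (of_real u * z) ^ n = of_real s" "s \<le> 0"
      by (auto simp: S_def elim!: nonpos_Reals_cases)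
    then have eq: "of_real (u ^ n) * z ^ n = of_real (1 - s)"
      by (simp add: power_mult_distrib algebra_simps)
    then have u: "u ^ n > 0" "u ^ n \<le> 1"
      using s that n by (auto simp: power_le_one zero_less_power_eq power_0_left intro!: zero_less_power le_neq_trans)
    have "of_real (u ^ n) \<noteq> (0::complex)"
      using u by (simp only: of_real_eq_0_iff)
    then have "z ^ n = of_real (1 - s) / of_real (u ^ n)"
      using eq by (metis nonzero_eq_divide_eq mult.commute)
    then have "z ^ n = of_real ((1 - s) / u ^ n)"
      by simp
    moreover have "(1 - s) / u ^ n \<ge> 1"
      using u s by simp
    ultimately have "1 - z ^ n = of_real (1 - (1 - s) / u ^ n)" "1 - (1 - s) / u ^ n \<le> 0"
      by simp_all
    then have "1 - z ^ n \<in> \<real>\<^sub>\<le>\<^sub>0"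
      by (metis nonpos_Reals_of_real_iff)
    then show False using that by (auto simp: S_def)
  qed
  have "starlike S"
    unfolding starlike_def
  proof (intro bexI ballI subsetI)
    show "0 \<in> S" using n by (auto simp: S_def power_0_left)
    fix x y :: complex assume "x \<in> S" "y \<in> closed_segment 0 x"
    then show "y \<in> S"
      using scale by (auto simp: in_segment scaleR_conv_of_real)
  qed
  moreover have hol: "d holomorphic_on S"
    unfolding d_def S_def by (intro holomorphic_intros) auto
  ultimately obtain \<Phi> where \<Phi>: "\<And>z. z \<in> S \<Longrightarrow> (\<Phi> has_field_derivative d z) (at z)"
    using holomorphic_starlike_primitive[of S d "{}"] opn
    by (auto simp: holomorphic_on_imp_continuous_on holomorphic_on_imp_differentiable_at)
  have ball: "z \<in> S" if "cmod z < 1" for z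
  proof -
    have "cmod (z ^ n) < 1" using n that by (simp add: norm_power power_less_one_iff)
    then show ?thesis
      using complex_Re_le_cmod[of "z ^ n"] by (auto simp: S_def complex_nonpos_Reals_iff)
  qed
  obtain c where c: "\<And>z. z \<in> ball 0 1 \<Longrightarrow> \<Phi> z - ngon_map n z = c"
  proof -
    have "((\<lambda>z. \<Phi> z - ngon_map n z) has_field_derivative 0) (at z within ball 0 1)" if "z \<in> ball 0 1" for z
      using DERIV_diff[OF \<Phi>[OF ball] DERIV_ngon_map[OF n], of z] that
      by (simp add: d_def has_field_derivative_at_within)
    then show ?thesis
      using has_field_derivative_zero_constant[of "ball 0 1" "\<lambda>z. \<Phi> z - ngon_map n z"] that by auto
  qed
  \<comment> \<open>A boundary point is reached along its radius: \<open>e\<close> equals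
    \<open>c\<close> for \<open>u < 1\<close>, and both maps are continuous up to
    \<open>u = 1\<close>.\<close>
  have eq: "ngon_map n z = \<Phi> z - c" if z: "z \<in> S" "cmod z \<le> 1" for z
  proof -
    define e where "e = (\<lambda>u::real. \<Phi> (of_real u * z) - ngon_map n (of_real u * z))"
    have "continuous_on S \<Phi>"
      by (meson \<Phi> DERIV_isCont continuous_at_imp_continuous_on)
    then have "continuous_on {0..1} (\<lambda>u. \<Phi> (complex_of_real u * z))"
      by (rule continuous_on_compose2) (use scale[OF z(1)] in \<open>auto intro!: continuous_intros\<close>)
    moreover have "continuous_on {0..1} (\<lambda>u. ngon_map n (complex_of_real u * z))"
      by (rule continuous_on_compose2[OF continuous_on_ngon_map[OF n]])
        (use z(2) in \<open>auto intro!: continuous_intros mult_le_one simp: norm_mult\<close>)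
    ultimately have "continuous_on (closure {0..<1}) e"
      unfolding e_def by (simp add: continuous_on_diff)
    moreover have "e u = c" if "u \<in> {0..<1}" for u
      unfolding e_def
    proof (rule c)
      have "\<bar>u\<bar> * cmod z \<le> \<bar>u\<bar> * 1" using z by (intro mult_left_mono) auto
      then show "of_real u * z \<in> ball 0 1" using that by (simp add: norm_mult)
    qed
    ultimately have "e 1 = c"
      by (rule continuous_constant_on_closure) auto
    then show ?thesis by (simp add: e_def algebra_simps)
  qed
  \<comment> \<open>On the circle \<open>1 - cis s ^ n\<close> is \<open>2 * sin (n * s / 2)\<close>
    times \<open>cis (n * s / 2 - pi / 2)\<close>. The exponent \<open>- (2 / n)\<close> turns this
    angle into \<open>pi / n - s\<close>, and the factor \<open>cis s\<close> from the chain rule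
    cancels \<open>s\<close>, so the tangent direction is constant.\<close>
  have arc: "cis s \<in> S"
    "d (cis s) * (\<i> * cis s) = of_real ((2 * sin (real n * s / 2)) powr (- (2 / real n))) * (\<i> * cis (pi / real n))"
    if s: "s \<in> {0<..<2 * pi / real n}" for s
  proof -
    define x where "x = real n * s / 2"
    have x: "0 < x" "x < pi" using s n by (auto simp: x_def field_simps)
    then have sx: "sin x > 0" by (simp add: sin_gt_zero)
    \<comment> \<open>An explicit logarithm of \<open>1 - cis s ^ n\<close>. Its imaginary part lies
      strictly between \<open>- pi / 2\<close> and \<open>pi / 2\<close>, so it is the principal
      one.\<close>
    define w where "w = of_real (ln (2 * sin x)) + \<i> * of_real (x - pi / 2)"
    have w: "Im w = x - pi / 2" "Re w = ln (2 * sin x)" by (simp_all add: w_def)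
    have "1 - cis s ^ n = 1 - cis (2 * x)"
      by (simp add: Complex.DeMoivre x_def)
    also have "\<dots> = exp w"
      using sx by (simp add: complex_eq_iff Re_exp Im_exp w cos_diff sin_diff cos_double_sin sin_double power2_eq_square)
    finally have ex: "1 - cis s ^ n = exp w" .
    have Ln: "Ln (exp w) = w"
      by (rule Ln_exp) (use x w in auto)
    show "cis s \<in> S"
      unfolding S_def mem_Collect_eq ex
    proof
      assume "exp w \<in> \<real>\<^sub>\<le>\<^sub>0"
      then have "Re (exp w) \<le> 0" by (simp add: complex_nonpos_Reals_iff)
      moreover have "cos (x - pi / 2) > 0" using x by (intro cos_gt_zero_pi) auto
      ultimately show False by (simp add: Re_exp w mult_le_0_iff)
    qed
    have "d (cis s) = exp (- (2 / of_nat n) * w)"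
      unfolding d_def ex by (simp add: powr_def Ln)
    also have "- (2 / of_nat n) * w = of_real (- (2 / real n) * ln (2 * sin x)) + \<i> * of_real (pi / real n - s)"
      using n by (simp add: w_def x_def field_simps)
    also have "exp \<dots> = of_real ((2 * sin x) powr (- (2 / real n))) * cis (pi / real n - s)"
      using sx by (simp only: exp_add exp_of_real cis_conv_exp[symmetric]) (simp add: powr_def)
    finally have "d (cis s) * (\<i> * cis s) =
        of_real ((2 * sin x) powr (- (2 / real n))) * (\<i> * (cis (pi / real n - s) * cis s))"
      by (simp only: mult_ac)
    then show "d (cis s) * (\<i> * cis s) =
        of_real ((2 * sin (real n * s / 2)) powr (- (2 / real n))) * (\<i> * cis (pi / real n))"
      by (simp add: cis_mult x_def)
  qed
  have tI: "t \<in> {0<..<2 * pi / real n}" using t by simp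
  have "(cis has_vector_derivative \<i> * cis t) (at t)"
    by (auto simp: has_vector_derivative_complex_iff intro!: derivative_eq_intros)
  then have "((\<lambda>t. \<Phi> (cis t)) has_vector_derivative (\<i> * cis t) * d (cis t)) (at t)"
    using field_vector_diff_chain_at[of cis "\<i> * cis t" t \<Phi>] \<Phi>[OF arc(1)[OF tI]]
    by (simp add: o_def)
  then have "((\<lambda>t. \<Phi> (cis t) - c) has_vector_derivative (\<i> * cis t) * d (cis t)) (at t)"
    using has_vector_derivative_diff[OF _ has_vector_derivative_const[of c]] by fastforce
  then have "((\<lambda>t. ngon_map n (cis t)) has_vector_derivative (\<i> * cis t) * d (cis t)) (at t)"
    by (rule has_vector_derivative_transform_within_open[OF _ open_greaterThanLessThan tI])
      (use eq arc(1) in auto)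
  then show ?thesis
    using arc(2)[OF tI] by (simp add: mult.commute)
qed

text \<open>Rotating by minus half the arc angle makes the edge vertical. Then the real part has
  derivative 0 and the imaginary part has a nonnegative one, so the latter stays between its end
  values. The derivative exists only on the open arc; continuity covers the two ends.\<close>

lemma ngon_map_arc_in_segment:
  assumes n: "n \<ge> 3" and t: "0 \<le> t" "t \<le> 2 * pi / real n"
  shows "ngon_map n (cis t) \<in> closed_segment (ngon_vertex n 0) (ngon_vertex n 1)"
proof -
  define R where "R = ngon_radius n"
  define \<beta> where "\<beta> = pi / real n"
  define q where "q = (\<lambda>t. cis (- \<beta>) * ngon_map n (cis t))"
  define \<rho> where "\<rho> = (\<lambda>t. (2 * sin (real n * t / 2)) powr (- (2 / real n)))"
  have \<beta>: "\<beta> > 0" "\<beta> < pi" using n by (auto simp: \<beta>_def field_simps)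
  have t: "0 \<le> t" "t \<le> 2 * \<beta>" using t by (auto simp: \<beta>_def)
  have "continuous_on {0..2*\<beta>} (\<lambda>t. ngon_map n (cis t))"
    by (intro continuous_on_compose2[OF continuous_on_ngon_map[OF n]] continuous_intros) auto
  then have cont: "continuous_on {0..2*\<beta>} q"
    unfolding q_def by (intro continuous_intros)
  have der: "(q has_vector_derivative of_real (\<rho> s) * \<i>) (at s)" if "0 < s" "s < 2 * \<beta>" for s
  proof -
    have "(q has_vector_derivative cis (- \<beta>) * (of_real (\<rho> s) * (\<i> * cis \<beta>))) (at s)"
      unfolding q_def \<rho>_def \<beta>_def using that
      by (intro has_vector_derivative_mult_right ngon_map_arc_has_vector_derivative n) (auto simp: \<beta>_def)
    also have "cis (- \<beta>) * (of_real (\<rho> s) * (\<i> * cis \<beta>)) = of_real (\<rho> s) * \<i> * (cis (- \<beta>) * cis \<beta>)"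
      by (simp only: mult_ac)
    also have "\<dots> = of_real (\<rho> s) * \<i>" by (simp add: cis_mult)
    finally show ?thesis .
  qed
  have derRe: "((\<lambda>t. Re (q t)) has_real_derivative 0) (at s)"
    and derIm: "((\<lambda>t. Im (q t)) has_real_derivative \<rho> s) (at s)" if "0 < s" "s < 2 * \<beta>" for s
    using der[OF that] by (simp_all add: has_vector_derivative_complex_iff)
  have q0: "q 0 = of_real R * cis (- \<beta>)"
    using ngon_map_1[OF n] by (simp add: q_def R_def mult.commute)
  \<comment> \<open>The far end of the arc is an \<open>n\<close>-th root of unity, so the
    rotational symmetry yields its value from the one at 1.\<close>
  have q1: "q (2 * \<beta>) = of_real R * cis \<beta>"
  proof -
    have "cis (2 * \<beta>) ^ n = 1"
      unfolding Complex.DeMoivre using n by (simp add: \<beta>_def)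
    then have "ngon_map n (cis (2 * \<beta>) * 1) = cis (2 * \<beta>) * of_real R"
      using ngon_map_rotate[OF n, of 1 "cis (2 * \<beta>)"] ngon_map_1[OF n] by (simp add: R_def)
    moreover have "cis (- \<beta>) * cis (2 * \<beta>) = cis \<beta>" by (simp add: cis_mult)
    ultimately show ?thesis by (simp add: q_def mult.commute mult.left_commute)
  qed
  have "continuous_on {0..2 * \<beta>} (\<lambda>t. Re (q t))"
    using cont by (rule continuous_on_Re)
  then have "Re (q t) = Re (q 0)"
    using DERIV_isconst2[of 0 "2 * \<beta>" "\<lambda>t. Re (q t)" t] derRe t \<beta> by simp
  then have Re: "Re (q t) = R * cos \<beta>"
    by (simp add: q0)
  have contIm: "continuous_on A (\<lambda>t. Im (q t))" if "A \<subseteq> {0..2 * \<beta>}" for A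
    using continuous_on_subset[OF cont that] by (rule continuous_on_Im)
  have \<rho>: "\<rho> s \<ge> 0" for s by (simp add: \<rho>_def)
  have incr: "\<exists>y. ((\<lambda>t. Im (q t)) has_real_derivative y) (at s) \<and> y \<ge> 0" if "0 < s" "s < 2 * \<beta>" for s
    using derIm[OF that] \<rho> by blast
  have "Im (q 0) \<le> Im (q t)"
  proof (rule DERIV_nonneg_imp_increasing_open[OF t(1)])
    show "continuous_on {0..t} (\<lambda>t. Im (q t))" using t by (intro contIm) auto
  qed (use incr t in auto)
  moreover have "Im (q t) \<le> Im (q (2 * \<beta>))"
  proof (rule DERIV_nonneg_imp_increasing_open[OF t(2)])
    show "continuous_on {t..2 * \<beta>} (\<lambda>t. Im (q t))" using t by (intro contIm) auto
  qed (use incr t in auto)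
  ultimately have Im: "- (R * sin \<beta>) \<le> Im (q t)" "Im (q t) \<le> R * sin \<beta>"
    unfolding q0 q1 by simp_all
  \<comment> \<open>Half the edge length; \<open>u\<close> below is the affine parameter of the
    point on the edge.\<close>
  define L where "L = R * sin \<beta>"
  have L: "L > 0" using ngon_radius_pos[OF n] \<beta> by (simp add: L_def R_def sin_gt_zero)
  define u where "u = (Im (q t) + L) / (2 * L)"
  have u: "0 \<le> u" "u \<le> 1" using Im L by (auto simp: u_def L_def[symmetric] field_simps)
  have "Im (q t) = (1 - u) * (- L) + u * L" using L by (simp add: u_def field_simps)
  then have "q t = (1 - u) *\<^sub>R q 0 + u *\<^sub>R q (2 * \<beta>)"
    unfolding q0 q1 complex_eq_iff by (simp add: Re L_def algebra_simps)
  then have "cis \<beta> * q t = (1 - u) *\<^sub>R (cis \<beta> * q 0) + u *\<^sub>R (cis \<beta> * q (2 * \<beta>))"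
    by (simp only: distrib_left mult_scaleR_right)
  moreover have "cis \<beta> * q t = ngon_map n (cis t)"
    by (simp add: q_def cis_mult flip: mult.assoc)
  moreover have "cis \<beta> * q 0 = ngon_vertex n 0"
    unfolding q0 ngon_vertex_def R_def by (simp add: cis_mult mult.left_commute)
  moreover have "cis \<beta> * q (2 * \<beta>) = ngon_vertex n 1"
    unfolding q1 ngon_vertex_def R_def by (simp add: cis_mult mult.left_commute \<beta>_def)
  ultimately show ?thesis using u by (auto simp: in_segment)
qed

section \<open>Vertices and supporting half-planes of the regular polygon\<close>

lemma cis_sector:
  assumes n: "n > 0" and z: "cmod z = 1"
  obtains j t where "j < n" "0 \<le> t" "t \<le> 2 * pi / real n" "z = cis (2 * pi * real j / real n) * cis t"
proof -
  define x where "x = Arg2pi z * real n / (2 * pi)"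
  have x: "0 \<le> x" "x < real n"
    using Arg2pi_ge_0[of z] Arg2pi_lt_2pi[of z] n by (auto simp: x_def field_simps)
  define j where "j = nat \<lfloor>x\<rfloor>"
  have j: "real j \<le> x" "x \<le> real j + 1" using x by (auto simp: j_def)
  define t where "t = 2 * pi / real n * (x - real j)"
  have jt: "j < n" "0 \<le> t" using j x by (auto simp: t_def)
  have "t \<le> 2 * pi / real n * 1"
    unfolding t_def using j by (intro mult_left_mono) auto
  then have t: "t \<le> 2 * pi / real n" by simp
  have "2 * pi * real j / real n + t = Arg2pi z"
    using n by (simp add: t_def x_def field_simps)
  moreover have "z = cis (Arg2pi z)"
    using Arg2pi_eq[of z] z by (simp add: cis_conv_exp)
  ultimately have "z = cis (2 * pi * real j / real n) * cis t"
    by (simp add: cis_mult)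
  then show thesis using that jt t by blast
qed

lemma ngon_vertex_rotate:
  "cis (2 * pi * real j / real n) * ngon_vertex n k = ngon_vertex n (j + k)"
  by (simp add: ngon_vertex_def cis_mult mult.left_commute add_divide_distrib distrib_left)

lemma ngon_vertex_n: "n > 0 \<Longrightarrow> ngon_vertex n n = ngon_vertex n 0"
  by (simp add: ngon_vertex_def)

text \<open>The outward normal of edge \<open>j\<close> has angle
  \<open>(2 * j + 1) * pi / n\<close>. Measured from it, every vertex sits at an odd multiple of
  \<open>pi / n\<close>, hence a nonzero one, of absolute size at most
  \<open>(2 * n - 1) * pi / n\<close>; the cosine there is at most
  \<open>cos (pi / n)\<close>.\<close>

lemma ngon_vertex_halfplane:
  assumes n: "n > 0" and R: "ngon_radius n \<ge> 0" and jk: "j < n" "k < n"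
  shows "cis ((2 * real j + 1) * pi / real n) \<bullet> ngon_vertex n k \<le> ngon_radius n * cos (pi / real n)"
proof -
  define m where "m = \<bar>2 * int k - 2 * int j - 1\<bar>"
  define x where "x = real_of_int m * pi / real n"
  have "2 * int k - 2 * int j - 1 \<noteq> 0" by presburger
  then have m: "m \<ge> 1" "m \<le> 2 * int n - 1" using jk by (auto simp: m_def)
  have "real_of_int m \<ge> 1" "real_of_int m \<le> 2 * real n - 1"
    using m by linarith+
  then have x: "pi / real n \<le> x" "x \<le> (2 * real n - 1) * pi / real n"
    unfolding x_def by (intro divide_right_mono; simp)+
  then have x2: "x \<le> 2 * pi - pi / real n"
    using n by (simp add: diff_divide_distrib left_diff_distrib)
  have "cos x \<le> cos (pi / real n)"
  proof (cases "x \<le> pi")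
    case True
    then show ?thesis using x by (intro cos_monotone_0_pi_le) auto
  next
    case False
    then have "cos (2 * pi - x) \<le> cos (pi / real n)"
      using x2 by (intro cos_monotone_0_pi_le) auto
    then show ?thesis by (simp add: cos_diff)
  qed
  moreover have "cos x = cos (2 * pi * real k / real n - (2 * real j + 1) * pi / real n)"
  proof -
    have "x = \<bar>2 * pi * real k / real n - (2 * real j + 1) * pi / real n\<bar>"
    proof -
      have "2 * pi * real k / real n - (2 * real j + 1) * pi / real n =
          real_of_int (2 * int k - 2 * int j - 1) * (pi / real n)"
        using n by (simp add: field_simps)
      then show ?thesis
        using n by (simp add: x_def m_def abs_mult)
    qed
    then show ?thesis by simp
  qed
  moreover have "cis ((2 * real j + 1) * pi / real n) \<bullet> ngon_vertex n k =
      ngon_radius n * cos (2 * pi * real k / real n - (2 * real j + 1) * pi / real n)"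
    by (simp add: ngon_vertex_def inner_complex_def cos_diff algebra_simps)
  ultimately show ?thesis
    using R by (simp add: mult_left_mono)
qed

text \<open>The bound of \<open>ngon_vertex_halfplane\<close> is attained at both ends of an edge,
  hence along all of it, which keeps edges out of the interior.\<close>

lemma ngon_vertex_edge:
  assumes "k = j \<or> k = Suc j"
  shows "cis ((2 * real j + 1) * pi / real n) \<bullet> ngon_vertex n k = ngon_radius n * cos (pi / real n)"
proof -
  have "cis ((2 * real j + 1) * pi / real n) \<bullet> ngon_vertex n k =
      ngon_radius n * cos (2 * pi * real k / real n - (2 * real j + 1) * pi / real n)"
    by (simp add: ngon_vertex_def inner_complex_def cos_diff algebra_simps)
  also have "2 * pi * real k / real n - (2 * real j + 1) * pi / real n = (if k = j then - (pi / real n) else pi / real n)"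
    using assms by (auto simp: field_simps simp flip: diff_divide_distrib minus_divide_left)
  finally show ?thesis by auto
qed

section \<open>Injectivity and the image of the disk\<close>

lemma inj_on_Re_deriv_pos:
  assumes "convex S"
    and der: "\<And>z. z \<in> S \<Longrightarrow> (f has_field_derivative f' z) (at z)"
    and pos: "\<And>z. z \<in> S \<Longrightarrow> Re (f' z) > 0"
  shows "inj_on f S"
proof (rule inj_onI, rule ccontr)
  fix w z assume wz: "w \<in> S" "z \<in> S" "f w = f z" "w \<noteq> z"
  have sub: "closed_segment w z \<subseteq> S"
    using wz \<open>convex S\<close> by (simp add: closed_segment_subset)
  \<comment> \<open>The Noshiro-Warschawski argument: dividing by \<open>z - w\<close> before using
    the mean value theorem leaves exactly \<open>Re (f' u)\<close>, which equal end values force to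
    be 0.\<close>
  have "\<exists>u. u \<in> closed_segment w z \<and>
      Re (f z / (z - w)) - Re (f w / (z - w)) = Re (f' u / (z - w) * (z - w))"
    using sub wz by (intro complex_mvt_line) (auto intro!: derivative_eq_intros der)
  then obtain u where u: "u \<in> closed_segment w z" "Re (f' u) = 0"
    using wz by auto
  then show False
    using pos[of u] sub by auto
qed

lemma ngon_map_conformal:
  assumes n: "n \<ge> 3"
  shows "inj_on (ngon_map n) (ball 0 1)"
    and "ngon_map n ` ball 0 1 = interior (convex hull (ngon_vertex n ` {..<n}))"
proof -
  define K where "K = convex hull (ngon_vertex n ` {..<n})"
  define G where "G = ngon_map n"
  show inj: "inj_on (ngon_map n) (ball 0 1)"
    by (rule inj_on_Re_deriv_pos[OF convex_ball DERIV_ngon_map Re_ngon_deriv_pos]) (use n in auto)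
  have K: "convex K" "compact K"
    unfolding K_def by (auto intro: finite_imp_compact_convex_hull)
  have vK: "ngon_vertex n k \<in> K" if "k \<le> n" for k
  proof (cases "k = n")
    case True
    then have "ngon_vertex n k = ngon_vertex n 0" using n ngon_vertex_n by simp
    then show ?thesis using n by (auto simp: K_def intro: hull_inc)
  next
    case False
    then show ?thesis using that by (auto simp: K_def intro: hull_inc)
  qed
  have KH: "K \<subseteq> {w. cis ((2 * real j + 1) * pi / real n) \<bullet> w \<le> ngon_radius n * cos (pi / real n)}" if "j < n" for j
    unfolding K_def using ngon_vertex_halfplane[OF _ _ that, of _] n ngon_radius_pos[OF n]
    by (intro hull_minimal convex_halfspace_le) auto
  \<comment> \<open>Membership in \<open>K\<close> feeds the maximum principle; avoiding
    \<open>interior K\<close> later makes the image relatively closed.\<close>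
  have bdry: "G z \<in> K \<and> G z \<notin> interior K" if z: "cmod z = 1" for z
  proof -
    obtain j t where jt: "j < n" "0 \<le> t" "t \<le> 2 * pi / real n" "z = cis (2 * pi * real j / real n) * cis t"
      using cis_sector[OF _ z] n by (metis gr0I not_numeral_le_zero)
    let ?w = "cis (2 * pi * real j / real n)"
    have "?w ^ n = cis (2 * pi * real j)" unfolding Complex.DeMoivre using n by simp
    also have "\<dots> = 1" by (rule cis_multiple_2pi) simp
    finally have "G z = ?w * ngon_map n (cis t)"
      unfolding G_def jt(4) using n by (intro ngon_map_rotate) auto
    moreover obtain u where u: "0 \<le> u" "u \<le> 1"
        "ngon_map n (cis t) = (1 - u) *\<^sub>R ngon_vertex n 0 + u *\<^sub>R ngon_vertex n 1"
      using ngon_map_arc_in_segment[OF n jt(2,3)] by (auto simp: in_segment)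
    ultimately have Gz: "G z = (1 - u) *\<^sub>R ngon_vertex n j + u *\<^sub>R ngon_vertex n (Suc j)"
      using ngon_vertex_rotate[of j n 0] ngon_vertex_rotate[of j n 1] by (simp add: algebra_simps)
    have "G z \<in> K"
      unfolding Gz using K(1) vK[of j] vK[of "Suc j"] jt(1) u by (auto simp: convex_alt)
    moreover have "G z \<notin> interior K"
    proof
      let ?a = "cis ((2 * real j + 1) * pi / real n)"
      assume "G z \<in> interior K"
      then have "G z \<in> interior {w. ?a \<bullet> w \<le> ngon_radius n * cos (pi / real n)}"
        using interior_mono[OF KH[OF jt(1)]] by blast
      then have "?a \<bullet> G z < ngon_radius n * cos (pi / real n)" by simp
      moreover have "?a \<bullet> G z = ngon_radius n * cos (pi / real n)"
        unfolding Gz inner_add_right inner_scaleR_right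
          ngon_vertex_edge[OF disjI1[OF refl]] ngon_vertex_edge[OF disjI2[OF refl]]
        by (simp add: algebra_simps)
      ultimately show False by simp
    qed
    ultimately show ?thesis by blast
  qed
  have hol: "G holomorphic_on ball 0 1"
    unfolding G_def by (rule holomorphic_on_ngon_map[OF n])
  have cont: "continuous_on (cball 0 1) G"
    unfolding G_def by (rule continuous_on_ngon_map[OF n])
  have sub: "G z \<in> K" if z: "z \<in> ball 0 1" for z
  proof (rule ccontr)
    assume "G z \<notin> K"
    then obtain a b where ab: "a \<bullet> G z < b" "\<And>x. x \<in> K \<Longrightarrow> a \<bullet> x > b"
      using separating_hyperplane_closed_point[OF K(1) compact_imp_closed[OF K(2)]] by blast
    \<comment> \<open>\<open>a \<bullet> w\<close> is the real part of \<open>cnj a * w\<close>, so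
      the separating line becomes a bound on the real part of a holomorphic function. The minus sign
      turns the lower bound on the circle into the upper bound that the maximum principle
      needs.\<close>
    have "(\<lambda>z. - cnj a * G z) holomorphic_on interior (ball 0 1)"
      using hol by (auto intro!: holomorphic_intros)
    moreover have "continuous_on (closure (ball 0 1)) (\<lambda>z. - cnj a * G z)"
      using cont by (auto intro!: continuous_intros)
    moreover have "Re (- cnj a * G x) \<le> - b" if "x \<in> frontier (ball 0 1)" for x
      using bdry[of x] ab(2)[of "G x"] that by (auto simp: inner_complex_def)
    ultimately have "Re (- cnj a * G z) \<le> - b"
      by (rule maximum_real_frontier[OF _ _ bounded_ball _ z])
    then show False using ab(1) by (auto simp: inner_complex_def)
  qed
  have "open (G ` ball 0 1)"
    using open_mapping_thm3[OF hol open_ball] inj by (simp add: G_def)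
  then have "G ` ball 0 1 \<subseteq> interior K"
    using sub by (intro interior_maximal) auto
  moreover have "interior K \<subseteq> G ` ball 0 1"
  proof -
    \<comment> \<open>Circle points map outside \<open>interior K\<close>, so adding them changes
      nothing inside it. The image is thus the trace of a compact set on
      \<open>interior K\<close>.\<close>
    have "G ` ball 0 1 = interior K \<inter> G ` cball 0 1"
    proof -
      have "G z \<in> G ` ball 0 1" if "G z \<in> interior K" "cmod z \<le> 1" for z
        using that bdry[of z] by (cases "cmod z = 1") auto
      then show ?thesis using calculation by auto
    qed
    moreover have "closed (G ` cball 0 1)"
      using cont by (intro compact_imp_closed compact_continuous_image) auto
    ultimately have "closedin (top_of_set (interior K)) (G ` ball 0 1)"
      by (simp add: closedin_closed_Int)
    moreover have "openin (top_of_set (interior K)) (G ` ball 0 1)"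
      using \<open>open (G ` ball 0 1)\<close> \<open>G ` ball 0 1 \<subseteq> interior K\<close> by (simp add: open_subset)
    moreover have "connected (interior K)"
      using K(1) by (simp add: convex_connected)
    ultimately have "G ` ball 0 1 = {} \<or> G ` ball 0 1 = interior K"
      unfolding connected_clopen by blast
    then show ?thesis by auto
  qed
  ultimately show "ngon_map n ` ball 0 1 = interior (convex hull (ngon_vertex n ` {..<n}))"
    by (simp add: G_def K_def)
qed

subsection \<open>Shearing\<close>

text \<open>Turns connected slices into horizontal segments, along which a one-variable derivative
  test can run.\<close>

lemma domain_CHD_horizontal_between:
  assumes "domain_CHD \<Omega>" "a \<in> \<Omega>" "b \<in> \<Omega>" "Im a = Im b" "Re a \<le> x" "x \<le> Re b"
  shows "Complex x (Im a) \<in> \<Omega>"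
proof -
  let ?L = "\<Omega> \<inter> {w. Im w = Im a}"
  have "connected (Re ` ?L)"
    using assms(1) by (intro connected_continuous_image continuous_intros) (auto simp: domain_CHD_def)
  moreover have "Re a \<in> Re ` ?L" "Re b \<in> Re ` ?L"
    using assms by auto
  ultimately have "x \<in> Re ` ?L"
    using assms(5,6) by (meson connected_iff_interval)
  then obtain w where "w \<in> ?L" "x = Re w" by auto
  then have "w = Complex x (Im a)" by (auto simp: complex_eq_iff)
  then show ?thesis using \<open>w \<in> ?L\<close> by auto
qed

text \<open>The quantity is the real part of \<open>(1 + w) / (1 - w)\<close>, that is,
  \<open>1 - (cmod w)\<^sup>2\<close> divided by the squared modulus \<open>D\<close> of
  \<open>1 - w\<close>.\<close>

lemma cayley_Re_pos:
  fixes w :: complex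
  assumes "cmod w < 1"
  shows "1 + 2 * Re (w / (1 - w)) > 0"
proof -
  define D where "D = (Re (1 - w))\<^sup>2 + (Im (1 - w))\<^sup>2"
  have "1 - w \<noteq> 0" using assms by auto
  then have D: "D > 0"
    unfolding D_def by (metis complex_neq_0)
  have "(cmod w)\<^sup>2 < 1"
    using assms by (simp add: abs_square_less_1)
  then have "(D + 2 * (Re w * Re (1 - w) + Im w * Im (1 - w))) > 0"
    unfolding D_def cmod_power2 by (simp add: power2_eq_square algebra_simps)
  then have "(D + 2 * (Re w * Re (1 - w) + Im w * Im (1 - w))) / D > 0"
    using D by simp
  moreover have "Re (w / (1 - w)) = (Re w * Re (1 - w) + Im w * Im (1 - w)) / D"
    unfolding D_def by (rule Re_divide)
  ultimately show ?thesis using D by (simp add: add_divide_distrib)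
qed

text \<open>One direction of the Clunie and Sheil-Small shear theorem. The inverse of
  \<open>\<phi>\<close> moves the question to \<open>\<Omega>\<close>, where the map only shifts
  points horizontally.\<close>

lemma harmonic_shear_univalent_CHD:
  assumes S: "is_harmonic_shear \<phi> \<omega> h g f"
  shows "inj_on f (ball 0 1)" "domain_CHD (f ` ball 0 1)"
proof -
  let ?D = "ball (0::complex) 1"
  from S obtain \<Omega> where CHD: "domain_CHD \<Omega>" and phi: "\<phi> holomorphic_on ?D" "inj_on \<phi> ?D" "\<phi> ` ?D = \<Omega>"
    by (auto simp: is_harmonic_shear_def conformal_onto_def)
  have h: "h holomorphic_on ?D" and g: "g holomorphic_on ?D"
    and w: "\<And>z. z \<in> ?D \<Longrightarrow> cmod (\<omega> z) < 1"
    and hg: "\<And>z. z \<in> ?D \<Longrightarrow> h z - g z = \<phi> z"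
    and dg: "\<And>z. z \<in> ?D \<Longrightarrow> deriv g z = \<omega> z * deriv h z"
    and f: "\<And>z. z \<in> ?D \<Longrightarrow> f z = h z + cnj (g z)"
    using S by (auto simp: is_harmonic_shear_def)
  obtain \<psi> where psi: "\<psi> holomorphic_on \<Omega>"
      "\<And>z. z \<in> ?D \<Longrightarrow> deriv \<phi> z * deriv \<psi> (\<phi> z) = 1" "\<And>z. z \<in> ?D \<Longrightarrow> \<psi> (\<phi> z) = z"
    using holomorphic_has_inverse[OF phi(1) open_ball phi(2)] phi(3) by metis
  define G where "G = (\<lambda>w. g (\<psi> w))"
  define F where "F = (\<lambda>w. w + of_real (2 * Re (G w)))"
  have opn: "open \<Omega>" and con: "connected \<Omega>" "\<Omega> \<noteq> {}"
    using CHD by (auto simp: domain_CHD_def)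
  have psi_in: "\<psi> w \<in> ?D" if "w \<in> \<Omega>" for w
    using that psi(3) phi(3) by auto
  \<comment> \<open>\<open>h + cnj g\<close> is \<open>(h - g) + (g + cnj g)\<close>, which is
    \<open>\<phi>\<close> plus twice the real part of \<open>g\<close>.\<close>
  have fF: "f z = F (\<phi> z)" if "z \<in> ?D" for z
    unfolding F_def G_def psi(3)[OF that] using f[OF that] by (simp add: complex_eq_iff flip: hg[OF that])
  \<comment> \<open>From \<open>\<phi>' = h' - g' = (1 - \<omega>) * h'\<close> and
    \<open>g' = \<omega> * h'\<close>, the quotient of \<open>g'\<close> by \<open>\<phi>'\<close>
    is \<open>\<omega> / (1 - \<omega>)\<close>.\<close>
  have dG: "(G has_field_derivative (\<omega> (\<psi> w) / (1 - \<omega> (\<psi> w)))) (at w)" if "w \<in> \<Omega>" for w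
  proof -
    define z where "z = \<psi> w"
    have z: "z \<in> ?D" "\<phi> z = w" "\<psi> w = z" using that psi_in phi(3) psi(3) by (auto simp: z_def)
    have d\<phi>: "deriv \<phi> z = deriv h z - deriv g z"
    proof (rule DERIV_imp_deriv)
      have "((\<lambda>z. h z - g z) has_field_derivative deriv h z - deriv g z) (at z)"
        using h g z by (intro derivative_intros holomorphic_derivI[of _ ?D]) auto
      then show "(\<phi> has_field_derivative deriv h z - deriv g z) (at z)"
        by (rule has_field_derivative_transform_within_open[OF _ open_ball[of 0 1]])
          (use hg z in auto)
    qed
    have "(G has_field_derivative deriv g (\<psi> w) * deriv \<psi> w) (at w)"
      unfolding G_def using psi(1) g that z opn
      by (intro DERIV_chain2 holomorphic_derivI[of g ?D] holomorphic_derivI[of \<psi> \<Omega>]) auto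
    moreover have "deriv g z * deriv \<psi> w = \<omega> z / (1 - \<omega> z)"
    proof -
      have "1 - \<omega> z \<noteq> 0" using w[OF z(1)] by auto
      moreover have "(deriv h z * deriv \<psi> w) * (1 - \<omega> z) = 1"
        using psi(2)[OF z(1)] d\<phi> dg[OF z(1)] z by (simp add: algebra_simps)
      ultimately have "deriv h z * deriv \<psi> w = 1 / (1 - \<omega> z)"
        by (simp only: eq_divide_eq) simp
      then show ?thesis
        using dg[OF z(1)] by (simp add: mult.assoc)
    qed
    ultimately show ?thesis using z by simp
  qed
  have mono: "Re (F a) < Re (F b)" if ab: "a \<in> \<Omega>" "b \<in> \<Omega>" "Im a = Im b" "Re a < Re b" for a b
  proof -
    define u where "u = (\<lambda>x. x + 2 * Re (G (Complex x (Im a))))"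
    have "u (Re a) < u (Re b)"
    proof (rule DERIV_pos_imp_increasing[OF ab(4)])
      fix x assume x: "Re a \<le> x" "x \<le> Re b"
      define p where "p = Complex x (Im a)"
      have p: "p \<in> \<Omega>"
        using domain_CHD_horizontal_between[OF CHD ab(1-3)] x by (auto simp: p_def)
      define c where "c = \<omega> (\<psi> p) / (1 - \<omega> (\<psi> p))"
      have "((\<lambda>x. Complex x (Im a)) has_vector_derivative 1) (at x)"
        unfolding Complex_eq by (auto intro!: derivative_eq_intros)
      then have "((\<lambda>x. G (Complex x (Im a))) has_vector_derivative 1 * c) (at x)"
        using field_vector_diff_chain_at[of "\<lambda>x. Complex x (Im a)" 1 x G c] dG[OF p]
        by (simp add: c_def p_def o_def)
      then have "((\<lambda>x. Re (G (Complex x (Im a)))) has_real_derivative Re c) (at x)"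
        by (auto simp: has_vector_derivative_complex_iff)
      then have "(u has_real_derivative 1 + 2 * Re c) (at x)"
        using DERIV_add[OF DERIV_ident DERIV_cmult[of _ "Re c" x UNIV 2]] by (simp add: u_def)
      moreover have "1 + 2 * Re c > 0"
        unfolding c_def using cayley_Re_pos w psi_in p by blast
      ultimately show "\<exists>y. (u has_real_derivative y) (at x) \<and> 0 < y" by blast
    qed
    moreover have "Complex (Re a) (Im a) = a" "Complex (Re b) (Im a) = b"
      using ab by (auto simp: complex_eq_iff)
    ultimately show ?thesis by (auto simp: u_def F_def)
  qed
  have ImF: "Im (F w) = Im w" for w by (simp add: F_def)
  have injF: "inj_on F \<Omega>"
  proof (rule inj_onI)
    fix a b assume ab: "a \<in> \<Omega>" "b \<in> \<Omega>" "F a = F b"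
    then have "Im a = Im b" using ImF by metis
    then have "Re a = Re b"
      using mono[of a b] mono[of b a] ab by (cases "Re a" "Re b" rule: linorder_cases) auto
    then show "a = b" using \<open>Im a = Im b\<close> by (simp add: complex_eq_iff)
  qed
  have "inj_on (F \<circ> \<phi>) ?D"
    using comp_inj_on[OF phi(2)] injF phi(3) by auto
  then show "inj_on f ?D"
    using fF by (subst inj_on_cong[where g = "F \<circ> \<phi>"]) auto
  have img: "f ` ?D = F ` \<Omega>"
    using fF phi(3) by (force simp: image_iff)
  have "continuous_on \<Omega> G"
    by (meson dG DERIV_isCont continuous_at_imp_continuous_on)
  then have contF: "continuous_on \<Omega> F"
    unfolding F_def by (intro continuous_intros)
  \<comment> \<open>\<open>F\<close> contains a real part and need not be holomorphic, so invariance
    of domain replaces the open mapping theorem.\<close>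
  have "open (F ` \<Omega>)"
    using invariance_of_domain contF opn injF by blast
  moreover have "connected (F ` \<Omega>)"
    using con contF by (simp add: connected_continuous_image)
  moreover have "connected (F ` \<Omega> \<inter> {w. Im w = t})" for t
  proof -
    have "F ` \<Omega> \<inter> {w. Im w = t} = F ` (\<Omega> \<inter> {w. Im w = t})"
      using ImF by auto
    moreover have "connected (\<Omega> \<inter> {w. Im w = t})"
      using CHD by (auto simp: domain_CHD_def)
    ultimately show ?thesis
      by (metis connected_continuous_image contF continuous_on_subset inf_le1)
  qed
  ultimately show "domain_CHD (f ` ?D)"
    using con by (auto simp: domain_CHD_def img)
qed

lemma domain_CHD_interior_convex:
  assumes "convex K" "interior K \<noteq> {}"
  shows "domain_CHD (interior K)"
proof -
  have "convex {w. Im w = t}" for t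
    using convex_hyperplane[of \<i> t] by (simp add: inner_complex_def)
  then show ?thesis
    using assms by (simp add: domain_CHD_def convex_connected convex_Int)
qed

section \<open>Verification of the shear conditions for the Appell series\<close>

theorem theorem3p1:
  fixes n :: nat and \<phi> h g f :: "complex \<Rightarrow> complex"
  assumes n: "n \<ge> 3"
    and phi: "\<And>z. z \<in> ball 0 1 \<Longrightarrow>
      \<phi> z = contour_integral (linepath 0 z) (\<lambda>\<zeta>. (1 - \<zeta> ^ n) powr (- (2 / of_nat n)))"
    and h: "\<And>z. z \<in> ball 0 1 \<Longrightarrow>
      h z = z * appell_F1 (1 / of_nat n) (1 + 2 / of_nat n) 1 (1 + 1 / of_nat n) (z ^ n) (- (z ^ n))"
    and g: "\<And>z. z \<in> ball 0 1 \<Longrightarrow>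
      g z = z ^ (2 * n + 1) / of_nat (2 * n + 1) *
        appell_F1 (2 + 1 / of_nat n) (1 + 2 / of_nat n) 1 (3 + 1 / of_nat n) (z ^ n) (- (z ^ n))"
    and f: "\<And>z. z \<in> ball 0 1 \<Longrightarrow> f z = h z + cnj (g z)"
  shows "(\<exists>P. regular_ngon n P \<and> conformal_onto \<phi> (ball 0 1) P) \<and>
    is_harmonic_shear \<phi> (\<lambda>z. z ^ (2 * n)) h g f \<and>
    inj_on f (ball 0 1) \<and> domain_CHD (f ` ball 0 1)"
proof -
  let ?D = "ball (0::complex) 1"
  define a where "a = 1 + 2 / complex_of_nat n"
  \<comment> \<open>The derivative of \<open>h\<close>; that of \<open>g\<close> is the same
    function times \<open>z ^ (2 * n)\<close>.\<close>
  define H where "H = (\<lambda>z::complex. (1 - z ^ n) powr (- a) / (1 + z ^ n))"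
  have n0: "n > 0" using n by simp
  have nz: "1 - z ^ n \<noteq> 0" "1 + z ^ n \<noteq> 0" if "z \<in> ?D" for z
  proof -
    have "cmod (z ^ n) < 1" using that n by (simp add: norm_power power_less_one_iff)
    then show "1 - z ^ n \<noteq> 0" "1 + z ^ n \<noteq> 0"
      by (auto simp: add_eq_0_iff)
  qed
  have phi_eq: "\<phi> z = ngon_map n z" if z: "z \<in> ?D" for z
  proof -
    have "((\<lambda>\<zeta>. (1 - \<zeta> ^ n) powr (- (2 / of_nat n))) has_contour_integral
        ngon_map n (pathfinish (linepath 0 z)) - ngon_map n (pathstart (linepath 0 z))) (linepath 0 z)"
    proof (rule contour_integral_primitive[of ?D])
      show "valid_path (linepath 0 z)" by (rule valid_path_linepath)
      show "path_image (linepath 0 z) \<subseteq> ?D"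
        using z by (simp add: closed_segment_subset)
    qed (use DERIV_ngon_map[OF n] in \<open>auto intro: has_field_derivative_at_within\<close>)
    then show ?thesis
      using phi[OF z] by (simp add: contour_integral_unique)
  qed
  have dh: "(h has_field_derivative H z) (at z)" if z: "z \<in> ?D" for z
  proof -
    have "((\<lambda>z. z * appell_F1 (1 / of_nat n) a 1 (1 + 1 / of_nat n) (z ^ n) (- (z ^ n)))
        has_field_derivative H z) (at z)"
      using appell_F1_primitive[of n 1 z a] n0 z by (simp add: H_def)
    then show ?thesis
      by (rule has_field_derivative_transform_within_open[OF _ open_ball z]) (simp add: h a_def)
  qed
  have dg: "(g has_field_derivative z ^ (2 * n) * H z) (at z)" if z: "z \<in> ?D" for z
  proof -
    \<comment> \<open>With \<open>p = 2 * n + 1\<close> the parameters \<open>p / n\<close> and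
      \<open>1 + p / n\<close> become \<open>2 + 1 / n\<close> and \<open>3 + 1 / n\<close>.\<close>
    have "of_nat (2 * n + 1) / of_nat n = 2 + 1 / complex_of_nat n"
      using n0 by (simp add: field_simps)
    then have "((\<lambda>z. z ^ (2 * n + 1) / of_nat (2 * n + 1) *
          appell_F1 (2 + 1 / of_nat n) a 1 (3 + 1 / of_nat n) (z ^ n) (- (z ^ n)))
        has_field_derivative z ^ (2 * n) * H z) (at z)"
      using appell_F1_primitive[of n "2 * n + 1" z a] n0 z
      by (simp add: H_def add.assoc[symmetric] del: of_nat_add of_nat_mult power_Suc of_nat_Suc)
    then show ?thesis
      by (rule has_field_derivative_transform_within_open[OF _ open_ball z]) (simp only: g a_def)
  qed
  have h0: "h 0 = 0" and g0: "g 0 = 0" using h[of 0] g[of 0] by simp_all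
  have hg: "h z - g z = \<phi> z" if z: "z \<in> ?D" for z
  proof -
    have "((\<lambda>z. h z - g z - ngon_map n z) has_field_derivative 0) (at x within ?D)" if x: "x \<in> ?D" for x
    proof -
      \<comment> \<open>Raising the exponent from \<open>- a\<close> to \<open>1 - a\<close>
        supplies the factor \<open>1 - x ^ n\<close>, which with the denominator
        \<open>1 + x ^ n\<close> of \<open>H\<close> combines to
        \<open>1 - x ^ (2 * n)\<close>.\<close>
      have "(1 - x ^ n) powr (- (2 / of_nat n)) = (1 - x ^ n) powr (1 + - a)"
        by (simp add: a_def)
      also have "\<dots> = (1 - x ^ n) * (1 - x ^ n) powr (- a)"
        using nz[OF x] by (simp only: powr_add) simp
      also have "\<dots> = (1 - x ^ n) * (1 + x ^ n) * H x"
        using nz[OF x] by (simp add: H_def)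
      also have "\<dots> = H x - x ^ n * x ^ n * H x"
        by (simp add: algebra_simps)
      also have "x ^ n * x ^ n = x ^ (2 * n)"
        by (simp add: mult_2 power_add)
      finally have "H x - x ^ (2 * n) * H x - (1 - x ^ n) powr (- (2 / of_nat n)) = 0"
        by simp
      moreover have "((\<lambda>z. h z - g z - ngon_map n z) has_field_derivative
          H x - x ^ (2 * n) * H x - (1 - x ^ n) powr (- (2 / of_nat n))) (at x)"
        using x by (intro DERIV_diff dh dg DERIV_ngon_map n) auto
      ultimately show ?thesis
        by (simp add: has_field_derivative_at_within)
    qed
    then obtain c where c: "\<And>x. x \<in> ?D \<Longrightarrow> h x - g x - ngon_map n x = c"
      using has_field_derivative_zero_constant[OF convex_ball, of 0 1 "\<lambda>z. h z - g z - ngon_map n z"] by blast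
    have "c = 0" using c[of 0] h0 g0 by simp
    then show ?thesis using c[OF z] phi_eq[OF z] by simp
  qed
  define P where "P = interior (convex hull (ngon_vertex n ` {..<n}))"
  have ngon: "regular_ngon n P"
    unfolding regular_ngon_def P_def ngon_vertex_def
    by (rule exI[of _ 0], rule exI[of _ "ngon_radius n"], rule exI[of _ 0])
      (use ngon_radius_pos[OF n] in simp)
  have conf: "conformal_onto \<phi> ?D P"
    unfolding conformal_onto_def
  proof (intro conjI)
    show "\<phi> holomorphic_on ?D"
      using phi_eq holomorphic_on_ngon_map[OF n] by (subst holomorphic_cong[OF refl]) auto
    show "inj_on \<phi> ?D"
      using ngon_map_conformal(1)[OF n] phi_eq by (subst inj_on_cong) auto
    show "\<phi> ` ?D = P"
      using ngon_map_conformal(2)[OF n] phi_eq by (simp add: P_def cong: image_cong_simp)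
  qed
  have "P \<noteq> {}" using conf by (auto simp: conformal_onto_def)
  then have CHD: "domain_CHD P"
    unfolding P_def by (intro domain_CHD_interior_convex convex_convex_hull)
  have shear: "is_harmonic_shear \<phi> (\<lambda>z. z ^ (2 * n)) h g f"
    unfolding is_harmonic_shear_def
  proof (intro conjI ballI)
    show "\<exists>\<Omega>. domain_CHD \<Omega> \<and> conformal_onto \<phi> ?D \<Omega>" using CHD conf by blast
    show "\<phi> 0 = 0" using phi_eq[of 0] by simp
    show "h holomorphic_on ?D" "g holomorphic_on ?D"
      unfolding holomorphic_on_open[OF open_ball] using dh dg by blast+
    show "cmod (z ^ (2 * n)) < 1" if "z \<in> ?D" for z
      using that n by (simp add: norm_power power_less_one_iff)
    show "deriv g z = z ^ (2 * n) * deriv h z" if "z \<in> ?D" for z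
      using DERIV_imp_deriv[OF dh[OF that]] DERIV_imp_deriv[OF dg[OF that]] by simp
  qed (use h0 g0 hg f in \<open>auto intro!: holomorphic_intros\<close>)
  show ?thesis
    using ngon conf shear harmonic_shear_univalent_CHD[OF shear] by blast
qed

end
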